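(* Let $X,Y$ be nonempty sets, and let $\mathcal G$ (resp. $\mathcal F$) be a complete subspace of $\overline{\mathbb R}^X$ (resp. $\overline{\mathbb R}^Y$). Then the following statements are equivalent: (i) there exists a kernel $b:X\times Y\to\overline{\mathbb R}$ such that $\mathcal G=\operatorname{Rg}(B)$ and $\mathcal F=\operatorname{Rg}(B^\circ)$; (ii) there exists an order anti-isomorphism $\bar F:\mathcal F\to\mathcal G$ commuting with the addition of scalars, i.e. $\bar F(f+\lambda)=\bar Ff-\lambda$ for all $\lambda\in\mathbb R$ and $f\in\mathcal F$. If these properties hold, then $\bar F$ can be taken as the restriction of $\bar B:\overline{\mathbb R}^Y\to\overline{\mathbb R}^X$ to $\operatorname{Rg}(B^\circ)$. Moreover, for $X=Y$, there exists an anti-involution $\bar F:\mathcal G\to\mathcal G$ commuting with the addition of scalars ($\bar F(f+\lambda)=\bar Ff-\lambda$ for $\lambda\in\mathbb R$) if and only if there exists a symmetric kernel $b:X\times X\to\overline{\mathbb R}$ (i.e. $b(x,y)=b(y,x)$) such that $\mathcal G=\operatorname{Rg}(B)$.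
   Context: $\overline{\mathbb R}=[-\infty,+\infty]$. Functions are ordered pointwise. A complete subspace of $\overline{\mathbb R}^X$ is a subset stable under arbitrary pointwise suprema (including the empty one, giving the constant $-\infty$) and under addition of real scalars. Given a kernel $b:X\times Y\to\overline{\mathbb R}$, define $\bar B:\overline{\mathbb R}^Y\to\overline{\mathbb R}^X$ and $\bar B^\circ:\overline{\mathbb R}^X\to\overline{\mathbb R}^Y$ by $\bar Bf(x)=\sup_{y\in Y}\,[b(x,y)-f(y)]$ and $\bar B^\circ h(y)=\sup_{x\in X}\,[b(x,y)-h(x)]$, with the convention that $-\infty$ is absorbing in these differences. $\operatorname{Rg}(B)=\bar B(\overline{\mathbb R}^Y)$ and $\operatorname{Rg}(B^\circ)=\bar B^\circ(\overline{\mathbb R}^X)$ are their ranges. An order anti-isomorphism is a bijection such that it and its inverse are order reversing. An anti-involution over $\mathcal G$ is an order reversing map $T:\mathcal G\to\mathcal G$ with $TT=\operatorname{Id}_{\mathcal G}$. *)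

theory Defs
  imports "HOL-Library.Extended_Real"
begin

text \<open>The sets \<open>X\<close> and \<open>Y\<close> are rendered as types (nonempty by construction). Pointwise order and
  pointwise suprema of functions into \<^typ>\<open>ereal\<close> are those of the library function instances;
  in particular \<open>Sup {}\<close> is the constant \<open>-\<infinity>\<close>.\<close>

definition add_scalar :: "('x \<Rightarrow> ereal) \<Rightarrow> real \<Rightarrow> 'x \<Rightarrow> ereal" where
  "add_scalar f c = (\<lambda>x. f x + ereal c)"

definition complete_subspace :: "('x \<Rightarrow> ereal) set \<Rightarrow> bool" where
  "complete_subspace G \<longleftrightarrow>
     (\<forall>S. S \<subseteq> G \<longrightarrow> Sup S \<in> G) \<and> (\<forall>g\<in>G. \<forall>c. add_scalar g c \<in> G)"

text \<open>The library subtraction satisfies \<open>\<infinity> - \<infinity> = \<infinity>\<close> and \<open>-\<infinity> - (-\<infinity>) = \<infinity>\<close>. In kernel transforms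
  \<open>-\<infinity>\<close> is absorbing instead, viewing \<open>a - c\<close> as \<open>a + (- c)\<close>: both differences are \<open>-\<infinity>\<close>.\<close>

definition diff_absorb :: "ereal \<Rightarrow> ereal \<Rightarrow> ereal" where
  "diff_absorb a c = (if a = - \<infinity> \<or> c = \<infinity> then - \<infinity> else a - c)"

definition Bbar :: "('x \<Rightarrow> 'y \<Rightarrow> ereal) \<Rightarrow> ('y \<Rightarrow> ereal) \<Rightarrow> 'x \<Rightarrow> ereal" where
  "Bbar b f = (\<lambda>x. SUP y. diff_absorb (b x y) (f y))"

definition Bbar_circ :: "('x \<Rightarrow> 'y \<Rightarrow> ereal) \<Rightarrow> ('x \<Rightarrow> ereal) \<Rightarrow> 'y \<Rightarrow> ereal" where
  "Bbar_circ b h = (\<lambda>y. SUP x. diff_absorb (b x y) (h x))"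

definition order_anti_isomorphism ::
  "('y \<Rightarrow> ereal) set \<Rightarrow> ('x \<Rightarrow> ereal) set \<Rightarrow> (('y \<Rightarrow> ereal) \<Rightarrow> 'x \<Rightarrow> ereal) \<Rightarrow> bool" where
  "order_anti_isomorphism F G T \<longleftrightarrow>
     bij_betw T F G \<and> antimono_on F T \<and> antimono_on G (inv_into F T)"

definition anti_involution ::
  "('x \<Rightarrow> ereal) set \<Rightarrow> (('x \<Rightarrow> ereal) \<Rightarrow> 'x \<Rightarrow> ereal) \<Rightarrow> bool" where
  "anti_involution G T \<longleftrightarrow> T ` G \<subseteq> G \<and> antimono_on G T \<and> (\<forall>g\<in>G. T (T g) = g)"

definition commutes_with_scalars ::
  "('y \<Rightarrow> ereal) set \<Rightarrow> (('y \<Rightarrow> ereal) \<Rightarrow> 'x \<Rightarrow> ereal) \<Rightarrow> bool" where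
  "commutes_with_scalars F T \<longleftrightarrow>
     (\<forall>f\<in>F. \<forall>c. T (add_scalar f c) = (\<lambda>x. T f x - ereal c))"

end

(* The transforms Bbar b and Bbar_circ b form an antitone Galois connection, so they restrict to
   mutually inverse anti-isomorphisms between their ranges.  Conversely, an anti-isomorphism
   T : F \<rightarrow> G, precomposed with the projection of a function onto the largest element of F below it,
   is one half of a Galois connection between the full function spaces.  Every function f is the
   infimum over y of (\<lambda>_. \<infinity>)(y := 0) + f y, and Galois maps turn infima into suprema, so a Galois
   map commuting with scalars is determined by its values on these functions: it is Bbar b for
   b x y = T ((\<lambda>_. \<infinity>)(y := 0)) x.  If T is an involution, both halves of the connection agree,
   which makes b symmetric. *)

theory Submission imports Defs begin

section \<open>Subtraction with absorbing \<open>-\<infinity>\<close>\<close>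

text \<open>Scalar source of the Galois connection. It relies on the absorbing convention: with
  library subtraction it fails at \<open>a = c = -\<infinity>\<close>, \<open>d = 0\<close>.\<close>

lemma diff_absorb_le_iff: "diff_absorb a c \<le> d \<longleftrightarrow> diff_absorb a d \<le> c"
  by (cases a; cases c; cases d) (auto simp: diff_absorb_def)

lemma diff_absorb_real [simp]: "diff_absorb a (ereal r) = a - ereal r"
  by (cases a) (auto simp: diff_absorb_def)

lemma diff_absorb_zero [simp]: "diff_absorb a 0 = a"
  by (simp add: diff_absorb_def)

lemma diff_absorb_infinity [simp]: "diff_absorb a \<infinity> = - \<infinity>"
  by (simp add: diff_absorb_def)

text \<open>The value at \<open>-\<infinity>\<close> is the supremum of the values at reals, so
  tests at real numbers also settle this case.\<close>

lemma diff_absorb_minus_infinity_le_iff: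
  "diff_absorb a (- \<infinity>) \<le> d \<longleftrightarrow> (\<forall>r. a - ereal r \<le> d)"
proof (cases a; cases d)
  fix p q assume a: "a = ereal p" and d: "d = ereal q"
  have "\<not> a - ereal (p - q - 1) \<le> d"
    using a d by simp
  moreover have "\<not> diff_absorb a (- \<infinity>) \<le> d"
    using a d by (simp add: diff_absorb_def)
  ultimately show ?thesis by blast
qed (auto simp: diff_absorb_def)

lemma ereal_le_minus_infinity_iff:
  fixes a :: ereal
  shows "a \<le> - \<infinity> \<longleftrightarrow> (\<forall>r. a \<le> ereal r)"
  using ereal_bot by auto

lemma le_add_scalar_iff: "f \<le> add_scalar g c \<longleftrightarrow> add_scalar f (- c) \<le> g"
proof -
  have "f x \<le> g x + ereal c \<longleftrightarrow> f x + ereal (- c) \<le> g x" for x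
    by (cases "f x"; cases "g x") auto
  then show ?thesis
    by (simp add: le_fun_def add_scalar_def)
qed

section \<open>The Galois connection of a kernel\<close>

lemma Bbar_le_iff: "Bbar b f \<le> h \<longleftrightarrow> (\<forall>x y. diff_absorb (b x y) (f y) \<le> h x)"
  by (auto simp: le_fun_def Bbar_def SUP_le_iff)

lemma Bbar_circ_eq_Bbar: "Bbar_circ b = Bbar (\<lambda>y x. b x y)"
  by (auto simp: fun_eq_iff Bbar_def Bbar_circ_def)

lemma Bbar_galois: "Bbar b f \<le> h \<longleftrightarrow> Bbar_circ b h \<le> f"
  by (metis Bbar_le_iff Bbar_circ_eq_Bbar diff_absorb_le_iff)

lemma Bbar_antimono: "f \<le> g \<Longrightarrow> Bbar b g \<le> Bbar b f"
  by (meson Bbar_galois order_refl order_trans)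

lemma Bbar_circ_antimono: "f \<le> g \<Longrightarrow> Bbar_circ b g \<le> Bbar_circ b f"
  by (simp add: Bbar_circ_eq_Bbar Bbar_antimono)

lemma Bbar_circ_Bbar_circ: "Bbar_circ b (Bbar b (Bbar_circ b h)) = Bbar_circ b h"
  by (meson Bbar_galois Bbar_circ_antimono antisym order_refl)

lemma Bbar_Bbar_circ_Bbar: "Bbar b (Bbar_circ b (Bbar b f)) = Bbar b f"
  by (meson Bbar_galois Bbar_antimono antisym order_refl)

lemma Bbar_add_scalar: "Bbar b (add_scalar f c) = (\<lambda>x. Bbar b f x - ereal c)"
proof -
  have eq: "(\<lambda>x. h x - ereal c) = add_scalar h (- c)" for h :: "'a \<Rightarrow> ereal"
    by (auto simp: fun_eq_iff add_scalar_def minus_ereal_def)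
  \<comment> \<open>Functions with the same upper bounds are equal, so the scalar is moved across an
    inequality and never out of a \<open>SUP\<close>.\<close>
  have "diff_absorb a (u + ereal c) \<le> d \<longleftrightarrow> diff_absorb a u \<le> d + ereal c" for a u d
    by (cases a; cases u; cases d) (auto simp: diff_absorb_def algebra_simps)
  then have "Bbar b (add_scalar f c) \<le> h \<longleftrightarrow> Bbar b f \<le> add_scalar h c" for h
    unfolding Bbar_le_iff add_scalar_def by simp
  then have "Bbar b (add_scalar f c) \<le> h \<longleftrightarrow> (\<lambda>x. Bbar b f x - ereal c) \<le> h" for h
    unfolding eq by (simp add: le_add_scalar_iff)
  then show ?thesis
    by (meson antisym order_refl)
qed

lemma Bbar_commutes_with_scalars: "commutes_with_scalars F (Bbar b)"
  by (simp add: commutes_with_scalars_def Bbar_add_scalar)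

lemma Bbar_order_anti_isomorphism:
  "order_anti_isomorphism (range (Bbar_circ b)) (range (Bbar b)) (Bbar b)"
proof -
  let ?F = "range (Bbar_circ b)" and ?G = "range (Bbar b)"
  have bij: "bij_betw (Bbar b) ?F ?G"
    by (rule bij_betw_byWitness[where f' = "Bbar_circ b"])
      (auto simp: Bbar_circ_Bbar_circ Bbar_Bbar_circ_Bbar)
  \<comment> \<open>With the inverse identified, its antitonicity is that of
    \<open>Bbar_circ b\<close>.\<close>
  have "inv_into ?F (Bbar b) g = Bbar_circ b g" if "g \<in> ?G" for g
    using that bij
    by (auto simp: bij_betw_def Bbar_Bbar_circ_Bbar intro!: inv_into_f_eq)
  then show ?thesis
    using bij by (auto simp: order_anti_isomorphism_def monotone_on_def
        intro: Bbar_antimono Bbar_circ_antimono)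
qed

section \<open>Recovering the kernel\<close>

text \<open>Away from \<open>y\<close>, subtracting \<open>\<infinity>\<close> leaves
  \<open>-\<infinity>\<close>, which is neutral for the supremum.\<close>

lemma Bbar_delta: "Bbar b ((\<lambda>_. \<infinity>)(y := 0)) x = b x y"
proof -
  have "diff_absorb (b x z) (((\<lambda>_. \<infinity>)(y := 0)) z) = (if z = y then b x y else - \<infinity>)" for z
    by simp
  then show ?thesis
    unfolding Bbar_def by (auto intro!: antisym SUP_least SUP_upper2[of y] simp del: fun_upd_apply)
qed

lemma galois_commuting_with_scalars_eq_Bbar:
  assumes galois: "\<And>f h. T f \<le> h \<longleftrightarrow> S h \<le> f"
    and scalars: "\<And>f c. T (add_scalar f c) = (\<lambda>x. T f x - ereal c)"
  shows "T = Bbar (\<lambda>x y. T ((\<lambda>_. \<infinity>)(y := 0)) x)" (is "T = Bbar ?b")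
    and "S = Bbar_circ (\<lambda>x y. T ((\<lambda>_. \<infinity>)(y := 0)) x)"
proof -
  \<comment> \<open>A bound on \<open>S h\<close> at the single point \<open>y\<close> is a bound by
    a shifted test function, equal to \<open>\<infinity>\<close> elsewhere; the connection turns it
    into a condition on \<open>T\<close>.\<close>
  have S_le_real: "S h y \<le> ereal r \<longleftrightarrow> (\<forall>x. ?b x y - ereal r \<le> h x)" for h y r
  proof -
    have "S h y \<le> ereal r \<longleftrightarrow> S h \<le> add_scalar ((\<lambda>_. \<infinity>)(y := 0)) r"
      by (auto simp: le_fun_def add_scalar_def)
    also have "\<dots> \<longleftrightarrow> (\<forall>x. ?b x y - ereal r \<le> h x)"
      unfolding galois[symmetric] scalars by (simp add: le_fun_def)
    finally show ?thesis .
  qed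
  have "S h y \<le> v \<longleftrightarrow> (\<forall>x. diff_absorb (?b x y) v \<le> h x)" for h y v
  proof (cases v)
    case (real r)
    then show ?thesis by (simp add: S_le_real)
  next
    case PInf
    then show ?thesis by (simp add: diff_absorb_def)
  next
    case MInf
    have "S h y \<le> - \<infinity> \<longleftrightarrow> (\<forall>x. diff_absorb (?b x y) (- \<infinity>) \<le> h x)"
      unfolding ereal_le_minus_infinity_iff diff_absorb_minus_infinity_le_iff S_le_real by blast
    with MInf show ?thesis by simp
  qed
  \<comment> \<open>Now \<open>T\<close> and \<open>Bbar ?b\<close> are both adjoint to
    \<open>S\<close>, and adjoints are unique.\<close>
  then have *: "S h \<le> f \<longleftrightarrow> Bbar ?b f \<le> h" for f h
    by (auto simp: le_fun_def[of "S h"] Bbar_le_iff)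
  then show "T = Bbar ?b"
    by (metis (no_types, lifting) ext galois antisym order_refl)
  show "S = Bbar_circ ?b"
    using * by (metis (no_types, lifting) ext Bbar_galois antisym order_refl)
qed

section \<open>Projection onto a complete subspace\<close>

definition floor_in :: "('x \<Rightarrow> ereal) set \<Rightarrow> ('x \<Rightarrow> ereal) \<Rightarrow> 'x \<Rightarrow> ereal" where
  "floor_in G f = Sup {g \<in> G. g \<le> f}"

context
  fixes G :: "('x \<Rightarrow> ereal) set"
  assumes G: "complete_subspace G"
begin

lemma floor_in_mem: "floor_in G f \<in> G"
  using G by (simp add: complete_subspace_def floor_in_def)

text \<open>The projection is right adjoint to the inclusion of \<open>G\<close> into all
  functions.\<close>

lemma le_floor_in_iff: "g \<in> G \<Longrightarrow> g \<le> floor_in G f \<longleftrightarrow> g \<le> f"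
  unfolding floor_in_def
  by (rule iffI, erule order_trans) (auto intro: Sup_least Sup_upper)

lemma floor_in_eq: "g \<in> G \<Longrightarrow> floor_in G g = g"
  by (meson antisym floor_in_mem le_floor_in_iff order_refl)

lemma range_floor_in: "range (floor_in G) = G"
  using floor_in_mem floor_in_eq by (metis image_subset_iff rangeI subsetI subset_antisym)

lemma add_scalar_mem: "g \<in> G \<Longrightarrow> add_scalar g c \<in> G"
  using G by (auto simp: complete_subspace_def)

text \<open>Shifting by \<open>c\<close> is a bijection of \<open>G\<close> with inverse the shift
  by \<open>- c\<close>. Both sides lie in \<open>G\<close>, so comparing the elements of
  \<open>G\<close> below them suffices.\<close>

lemma floor_in_add_scalar: "floor_in G (add_scalar f c) = add_scalar (floor_in G f) c"
proof -
  have "g \<le> floor_in G (add_scalar f c) \<longleftrightarrow> g \<le> add_scalar (floor_in G f) c" if "g \<in> G" for g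
    using that by (simp add: le_floor_in_iff add_scalar_mem le_add_scalar_iff)
  then show ?thesis
    by (meson add_scalar_mem antisym floor_in_mem order_refl)
qed

end

section \<open>From anti-isomorphisms to kernels\<close>

text \<open>Keeping \<open>S\<close> separate from \<open>inv_into F T\<close> serves both uses: the
  inverse of an anti-isomorphism, and \<open>S = T\<close> for an involution.\<close>

lemma anti_isomorphism_kernel:
  assumes G: "complete_subspace G" and F: "complete_subspace F"
    and maps: "T ` F = G" "S ` G = F"
    and galois: "\<And>f g. f \<in> F \<Longrightarrow> g \<in> G \<Longrightarrow> T f \<le> g \<longleftrightarrow> S g \<le> f"
    and scalars: "commutes_with_scalars F T"
  obtains b where "Bbar b = T \<circ> floor_in F" "Bbar_circ b = S \<circ> floor_in G"
    "range (Bbar b) = G" "range (Bbar_circ b) = F"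
proof -
  let ?T = "T \<circ> floor_in F" and ?S = "S \<circ> floor_in G"
  have TF: "T f \<in> G" if "f \<in> F" for f using maps that by blast
  have SG: "S g \<in> F" if "g \<in> G" for g using maps that by blast
  have "?T f \<le> h \<longleftrightarrow> ?S h \<le> f" for f h
  proof -
    \<comment> \<open>Each projection can be inserted or removed because the other side of the
      inequality lies in its subspace.\<close>
    have "?T f \<le> h \<longleftrightarrow> T (floor_in F f) \<le> floor_in G h"
      by (simp add: le_floor_in_iff[OF G] TF floor_in_mem[OF F])
    also have "\<dots> \<longleftrightarrow> S (floor_in G h) \<le> floor_in F f"
      by (simp add: galois floor_in_mem F G)
    also have "\<dots> \<longleftrightarrow> ?S h \<le> f"
      by (simp add: le_floor_in_iff[OF F] SG floor_in_mem[OF G])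
    finally show ?thesis .
  qed
  moreover have "?T (add_scalar f c) = (\<lambda>x. ?T f x - ereal c)" for f c
    using scalars by (simp add: commutes_with_scalars_def floor_in_add_scalar[OF F] floor_in_mem[OF F])
  ultimately obtain b where b: "?T = Bbar b" "?S = Bbar_circ b"
    using galois_commuting_with_scalars_eq_Bbar[of ?T ?S] by blast
  moreover have "range ?T = G" "range ?S = F"
    using maps range_floor_in[OF F] range_floor_in[OF G] by (metis image_comp)+
  ultimately show thesis
    using that[of b] by simp
qed

theorem theorem10:
  fixes G :: "('x \<Rightarrow> ereal) set" and F :: "('y \<Rightarrow> ereal) set"
  assumes "complete_subspace G" and "complete_subspace F"
  shows "((\<exists>b :: 'x \<Rightarrow> 'y \<Rightarrow> ereal. G = range (Bbar b) \<and> F = range (Bbar_circ b)) \<longleftrightarrow>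
          (\<exists>T :: ('y \<Rightarrow> ereal) \<Rightarrow> 'x \<Rightarrow> ereal.
             order_anti_isomorphism F G T \<and> commutes_with_scalars F T))
       \<and> (\<forall>b :: 'x \<Rightarrow> 'y \<Rightarrow> ereal. G = range (Bbar b) \<and> F = range (Bbar_circ b) \<longrightarrow>
            order_anti_isomorphism F G (Bbar b) \<and> commutes_with_scalars F (Bbar b))
       \<and> ((\<exists>T :: ('x \<Rightarrow> ereal) \<Rightarrow> 'x \<Rightarrow> ereal.
             anti_involution G T \<and> commutes_with_scalars G T) \<longleftrightarrow>
          (\<exists>b :: 'x \<Rightarrow> 'x \<Rightarrow> ereal. (\<forall>x y. b x y = b y x) \<and> G = range (Bbar b)))"
proof (intro conjI allI impI iffI)
  assume "\<exists>b. G = range (Bbar b) \<and> F = range (Bbar_circ b)"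
  then show "\<exists>T. order_anti_isomorphism F G T \<and> commutes_with_scalars F T"
    using Bbar_order_anti_isomorphism Bbar_commutes_with_scalars by blast
next
  assume "\<exists>T. order_anti_isomorphism F G T \<and> commutes_with_scalars F T"
  then obtain T where T: "bij_betw T F G" "\<And>f g. f \<in> F \<Longrightarrow> g \<in> F \<Longrightarrow> f \<le> g \<Longrightarrow> T g \<le> T f"
      "\<And>f g. f \<in> G \<Longrightarrow> g \<in> G \<Longrightarrow> f \<le> g \<Longrightarrow> inv_into F T g \<le> inv_into F T f"
    and scalars: "commutes_with_scalars F T"
    by (auto simp: order_anti_isomorphism_def monotone_on_def)
  let ?S = "inv_into F T"
  have maps: "T ` F = G" "?S ` G = F"
    using T(1) bij_betw_inv_into[OF T(1)] by (auto simp: bij_betw_def)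
  have inv: "?S (T f) = f" if "f \<in> F" for f
    using bij_betw_inv_into_left[OF T(1)] that .
  have inv': "T (?S g) = g" if "g \<in> G" for g
    using bij_betw_inv_into_right[OF T(1)] that .
  have galois: "T f \<le> g \<longleftrightarrow> ?S g \<le> f" if "f \<in> F" "g \<in> G" for f g
  proof
    have mem: "T f \<in> G" "?S g \<in> F" using maps that by blast+
    show "?S g \<le> f" if "T f \<le> g"
      using T(3)[OF mem(1) \<open>g \<in> G\<close> that] by (simp add: inv \<open>f \<in> F\<close>)
    show "T f \<le> g" if "?S g \<le> f"
      using T(2)[OF mem(2) \<open>f \<in> F\<close> that] by (simp add: inv' \<open>g \<in> G\<close>)
  qed
  show "\<exists>b. G = range (Bbar b) \<and> F = range (Bbar_circ b)"
    using anti_isomorphism_kernel[OF assms maps galois scalars] by metis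
next
  fix b assume "G = range (Bbar b) \<and> F = range (Bbar_circ b)"
  then show "order_anti_isomorphism F G (Bbar b)" "commutes_with_scalars F (Bbar b)"
    using Bbar_order_anti_isomorphism Bbar_commutes_with_scalars by blast+
next
  assume "\<exists>T. anti_involution G T \<and> commutes_with_scalars G T"
  then obtain T where T: "T ` G \<subseteq> G" "\<And>f g. f \<in> G \<Longrightarrow> g \<in> G \<Longrightarrow> f \<le> g \<Longrightarrow> T g \<le> T f"
      "\<And>g. g \<in> G \<Longrightarrow> T (T g) = g"
    and scalars: "commutes_with_scalars G T"
    by (auto simp: anti_involution_def monotone_on_def)
  have mem: "T g \<in> G" if "g \<in> G" for g using T(1) that by blast
  have maps: "T ` G = G"
    using T(1,3) by (metis image_eqI mem subsetI subset_antisym)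
  have galois: "T f \<le> g \<longleftrightarrow> T g \<le> f" if "f \<in> G" "g \<in> G" for f g
    using T(2,3) mem that by metis
  \<comment> \<open>Taking \<open>S = T\<close> makes both transforms of \<open>b\<close> the same
    map.\<close>
  obtain b where b: "Bbar b = T \<circ> floor_in G" "Bbar_circ b = T \<circ> floor_in G" "range (Bbar b) = G"
    using anti_isomorphism_kernel[OF assms(1,1) maps maps galois scalars] by metis
  \<comment> \<open>At the test function of \<open>y\<close>, evaluated at \<open>x\<close>,
    \<open>Bbar b\<close> gives \<open>b x y\<close> and \<open>Bbar_circ b\<close> gives
    \<open>b y x\<close>.\<close>
  have "b x y = b y x" for x y
    using Bbar_delta[of b y x] Bbar_delta[of "\<lambda>y x. b x y" y x] b(1,2)
    by (metis Bbar_circ_eq_Bbar)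
  with b(3) show "\<exists>b. (\<forall>x y. b x y = b y x) \<and> G = range (Bbar b)"
    by blast
next
  assume "\<exists>b :: 'x \<Rightarrow> 'x \<Rightarrow> ereal. (\<forall>x y. b x y = b y x) \<and> G = range (Bbar b)"
  then obtain b :: "'x \<Rightarrow> 'x \<Rightarrow> ereal" where sym: "\<And>x y. b x y = b y x" and G: "G = range (Bbar b)"
    by blast
  have "Bbar_circ b = Bbar b"
    using sym by (metis (no_types, lifting) ext Bbar_circ_eq_Bbar)
  then have "anti_involution G (Bbar b)"
    using Bbar_Bbar_circ_Bbar[of b]
    by (auto simp: G anti_involution_def monotone_on_def intro: Bbar_antimono)
  then show "\<exists>T. anti_involution G T \<and> commutes_with_scalars G T"
    using Bbar_commutes_with_scalars by blast
qed

end
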